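(* Let $n\geqslant3$. The generic system on the $n$-sphere, i.e. the properly superintegrable system on the (open dense part of the) round sphere with metric $$g=\sum_{m=1}^n\Big(\prod_{k=2}^m\sin^2(\phi_{k-1})\Big)d\phi_m^2$$ and potential $$V=a_0+\sum_{m=1}^n\frac{a_m}{\cos^2(\phi_m)\prod_{k=2}^m\sin^2(\phi_{k-1})}+\frac{a_{n+1}}{\prod_{k=1}^n\sin^2(\phi_k)}$$ with parameters $a_0,\dots,a_{n+1}$, is not conformally equivalent to a properly superintegrable system on flat space.
   Context: A (second order) properly superintegrable system on an $n$-dimensional pseudo-Riemannian manifold is a Hamiltonian $H=g^{ij}p_ip_j+V$ with $2n-1$ functionally independent integrals (including $H$) of the form $F=K^{ij}p_ip_j+W$ with $\{F,H\}=0$; thus $K_{ij}$ is a Killing tensor and $dW=K\,dV$, so $d(K\,dV)=0$. The system is considered with the full space $\mathcal V^{\max}$ of compatible potentials (here the $(n+2)$-parameter family above) and all Killing tensors compatible with them. It is in particular a conformally superintegrable system, i.e. one with $2n-1$ functionally independent conformal integrals, $\{F,H\}=2\omega(p)H$ with $\omega$ a 1-form. Two systems with Hamiltonians $H=g^{ij}p_ip_j+V$ and $\tilde H=\tilde g^{ij}p_ip_j+\tilde V$ are conformally equivalent if $\tilde H=\Omega^{-2}H$ for some function $\Omega$ (so $\tilde g=\Omega^2g$, $\tilde V=\Omega^{-2}V$), and if the trace-free parts of the associated (conformal) Killing tensors, viewed as $(2,0)$-tensors with upper indices, span the same linear space. *)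

theory Defs
  imports "HOL-Analysis.Analysis"
begin

text \<open>
  Everything is expressed in one coordinate chart, an open subset of \<^typ>\<open>real^'n\<close>. Functions and
  tensor fields are total functions on \<^typ>\<open>real^'n\<close>; only their values on the chart domain are
  meaningful.
\<close>

section \<open>Smooth functions on a chart\<close>

definition pd :: "'n \<Rightarrow> (real^'n::finite \<Rightarrow> real) \<Rightarrow> real^'n \<Rightarrow> real" where
  "pd i f x = frechet_derivative f (at x) (axis i 1)"

definition grad :: "(real^'n::finite \<Rightarrow> real) \<Rightarrow> real^'n \<Rightarrow> real^'n" where
  "grad f x = (\<chi> i. pd i f x)"

text \<open>All iterated partial derivatives exist and are (totally) differentiable; on an open set
  this is the class of infinitely differentiable functions.\<close>

definition smooth_on :: "(real^'n::finite) set \<Rightarrow> (real^'n \<Rightarrow> real) \<Rightarrow> bool" where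
  "smooth_on U f \<longleftrightarrow> (\<forall>is. \<forall>x\<in>U. foldr pd is f differentiable (at x))"

section \<open>Pseudo-Riemannian geometry\<close>

text \<open>A metric is given by its matrix of covariant components.\<close>

type_synonym 'n tensor2 = "real^'n \<Rightarrow> real^'n^'n"

definition pseudo_riemannian :: "(real^'n::finite) set \<Rightarrow> 'n tensor2 \<Rightarrow> bool" where
  "pseudo_riemannian U g \<longleftrightarrow>
     (\<forall>i j. smooth_on U (\<lambda>x. g x $ i $ j)) \<and>
     (\<forall>x\<in>U. transpose (g x) = g x \<and> invertible (g x))"

definition christoffel :: "('n::finite) tensor2 \<Rightarrow> 'n \<Rightarrow> 'n \<Rightarrow> 'n \<Rightarrow> real^'n \<Rightarrow> real" where
  "christoffel g l i j x =
     (\<Sum>m\<in>UNIV. matrix_inv (g x) $ l $ m *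
        (pd i (\<lambda>y. g y $ j $ m) x + pd j (\<lambda>y. g y $ i $ m) x - pd m (\<lambda>y. g y $ i $ j) x)) / 2"

text \<open>\<open>riemann g l k i j\<close> is the \<open>l\<close>-component of
  $R(\partial_i,\partial_j)\partial_k$.\<close>

definition riemann :: "('n::finite) tensor2 \<Rightarrow> 'n \<Rightarrow> 'n \<Rightarrow> 'n \<Rightarrow> 'n \<Rightarrow> real^'n \<Rightarrow> real" where
  "riemann g l k i j x =
     pd i (christoffel g l j k) x - pd j (christoffel g l i k) x
     + (\<Sum>m\<in>UNIV. christoffel g l i m x * christoffel g m j k x
                  - christoffel g l j m x * christoffel g m i k x)"

definition flat_on :: "(real^'n::finite) set \<Rightarrow> 'n tensor2 \<Rightarrow> bool" where
  "flat_on U g \<longleftrightarrow> (\<forall>x\<in>U. \<forall>l k i j. riemann g l k i j x = 0)"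

text \<open>\<open>cov_deriv g K k i j\<close> is $\nabla_k K_{ij}$ for a covariant tensor field.\<close>

definition cov_deriv :: "('n::finite) tensor2 \<Rightarrow> 'n tensor2 \<Rightarrow> 'n \<Rightarrow> 'n \<Rightarrow> 'n \<Rightarrow> real^'n \<Rightarrow> real" where
  "cov_deriv g K k i j x =
     pd k (\<lambda>y. K y $ i $ j) x
     - (\<Sum>l\<in>UNIV. christoffel g l k i x * K x $ l $ j + christoffel g l k j x * K x $ i $ l)"

definition killing_tensor :: "(real^'n::finite) set \<Rightarrow> 'n tensor2 \<Rightarrow> 'n tensor2 \<Rightarrow> bool" where
  "killing_tensor U g K \<longleftrightarrow>
     (\<forall>i j. smooth_on U (\<lambda>x. K x $ i $ j)) \<and>
     (\<forall>x\<in>U. transpose (K x) = K x) \<and>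
     (\<forall>x\<in>U. \<forall>i j k. cov_deriv g K i j k x + cov_deriv g K j k i x + cov_deriv g K k i j x = 0)"

text \<open>Contravariant components $K^{ij}$ of a covariant tensor field $K_{ij}$.\<close>

definition raise :: "('n::finite) tensor2 \<Rightarrow> 'n tensor2 \<Rightarrow> 'n tensor2" where
  "raise g K x = matrix_inv (g x) ** K x ** matrix_inv (g x)"

text \<open>Trace-free part of a contravariant tensor field.\<close>

definition tracefree_part :: "('n::finite) tensor2 \<Rightarrow> 'n tensor2 \<Rightarrow> 'n tensor2" where
  "tracefree_part g T x =
     T x - ((\<Sum>i\<in>UNIV. \<Sum>j\<in>UNIV. g x $ i $ j * T x $ i $ j) / real CARD('n)) *\<^sub>R matrix_inv (g x)"

text \<open>The compatibility condition $d(K\,dV) = 0$, where $K$ acts on one-forms as an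
  endomorphism: $(K\,dV)_i = K_{ij} g^{jk} \partial_k V$.\<close>

definition K_dV :: "('n::finite) tensor2 \<Rightarrow> 'n tensor2 \<Rightarrow> (real^'n \<Rightarrow> real) \<Rightarrow> real^'n \<Rightarrow> real^'n" where
  "K_dV g K V x = K x *v (matrix_inv (g x) *v grad V x)"

definition compatible ::
  "(real^'n::finite) set \<Rightarrow> 'n tensor2 \<Rightarrow> 'n tensor2 \<Rightarrow> (real^'n \<Rightarrow> real) \<Rightarrow> bool" where
  "compatible U g K V \<longleftrightarrow>
     (\<forall>x\<in>U. \<forall>i j. pd i (\<lambda>y. K_dV g K V y $ j) x = pd j (\<lambda>y. K_dV g K V y $ i) x)"

section \<open>Hamiltonians and integrals\<close>

text \<open>Functions on phase space take a position \<open>x\<close> and a momentum \<open>p\<close>.\<close>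

definition quadratic_observable ::
  "('n::finite) tensor2 \<Rightarrow> 'n tensor2 \<Rightarrow> (real^'n \<Rightarrow> real) \<Rightarrow> real^'n \<Rightarrow> real^'n \<Rightarrow> real" where
  "quadratic_observable g K W x p =
     (\<Sum>i\<in>UNIV. \<Sum>j\<in>UNIV. raise g K x $ i $ j * p $ i * p $ j) + W x"

definition hamiltonian ::
  "('n::finite) tensor2 \<Rightarrow> (real^'n \<Rightarrow> real) \<Rightarrow> real^'n \<Rightarrow> real^'n \<Rightarrow> real" where
  "hamiltonian g V x p =
     (\<Sum>i\<in>UNIV. \<Sum>j\<in>UNIV. matrix_inv (g x) $ i $ j * p $ i * p $ j) + V x"

definition poisson ::
  "(real^'n::finite \<Rightarrow> real^'n \<Rightarrow> real) \<Rightarrow> (real^'n \<Rightarrow> real^'n \<Rightarrow> real) \<Rightarrow> real^'n \<Rightarrow> real^'n \<Rightarrow> real" where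
  "poisson F G x p =
     (\<Sum>i\<in>UNIV. pd i (\<lambda>y. F y p) x * pd i (G x) p - pd i (F x) p * pd i (\<lambda>y. G y p) x)"

text \<open>The differentials of $F_0,\dots,F_{N-1}$ are linearly independent on a dense subset of phase
  space.\<close>

definition functionally_independent ::
  "(real^'n::finite) set \<Rightarrow> nat \<Rightarrow> (nat \<Rightarrow> real^'n \<Rightarrow> real^'n \<Rightarrow> real) \<Rightarrow> bool" where
  "functionally_independent U N F \<longleftrightarrow>
     U \<times> UNIV \<subseteq> closure {(x, p). x \<in> U \<and>
       (\<forall>c :: nat \<Rightarrow> real.
          (\<Sum>r<N. c r *\<^sub>R (grad (\<lambda>y. F r y p) x, grad (F r x) p)) = 0 \<longrightarrow> (\<forall>r<N. c r = 0))}"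

text \<open>The Hamiltonian of \<open>g\<close> and \<open>V\<close> has $2n-1$ functionally independent integrals
  $K^{ij}p_ip_j + W$, one of them the Hamiltonian itself, with all \<open>K\<close> taken from the set \<open>\<K>\<close>.\<close>

definition superintegrable_hamiltonian ::
  "(real^'n::finite) set \<Rightarrow> 'n tensor2 \<Rightarrow> 'n tensor2 set \<Rightarrow> (real^'n \<Rightarrow> real) \<Rightarrow> bool" where
  "superintegrable_hamiltonian U g \<K> V \<longleftrightarrow>
     (\<exists>K W. K 0 = g \<and> W 0 = V \<and>
        (\<forall>r < 2 * CARD('n) - 1. K r \<in> \<K> \<and> smooth_on U (W r) \<and>
           (\<forall>x\<in>U. \<forall>p. poisson (quadratic_observable g (K r) (W r)) (hamiltonian g V) x p = 0)) \<and>
        functionally_independent U (2 * CARD('n) - 1) (\<lambda>r. quadratic_observable g (K r) (W r)))"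

section \<open>Superintegrable systems\<close>

text \<open>A system is a connected chart domain with a metric, a space of potentials and a space of
  associated Killing tensors (covariant components).\<close>

record ('n::finite) system =
  dom :: "(real^'n) set"
  metric :: "'n tensor2"
  potentials :: "(real^'n \<Rightarrow> real) set"
  killing :: "'n tensor2 set"

definition compatible_potentials ::
  "(real^'n::finite) set \<Rightarrow> 'n tensor2 \<Rightarrow> 'n tensor2 set \<Rightarrow> (real^'n \<Rightarrow> real) set" where
  "compatible_potentials U g \<K> = {V. smooth_on U V \<and> (\<forall>K\<in>\<K>. compatible U g K V)}"

definition compatible_killing_tensors ::
  "(real^'n::finite) set \<Rightarrow> 'n tensor2 \<Rightarrow> (real^'n \<Rightarrow> real) set \<Rightarrow> 'n tensor2 set" where
  "compatible_killing_tensors U g \<V> = {K. killing_tensor U g K \<and> (\<forall>V\<in>\<V>. compatible U g K V)}"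

text \<open>Potentials and Killing tensors are maximal with respect to each other: the potentials form
  the full space of compatible potentials, and all compatible Killing tensors are included.\<close>

definition properly_superintegrable :: "('n::finite) system \<Rightarrow> bool" where
  "properly_superintegrable S \<longleftrightarrow>
     open (dom S) \<and> connected (dom S) \<and> dom S \<noteq> {} \<and>
     pseudo_riemannian (dom S) (metric S) \<and>
     potentials S = compatible_potentials (dom S) (metric S) (killing S) \<and>
     killing S = compatible_killing_tensors (dom S) (metric S) (potentials S) \<and>
     (\<forall>V \<in> potentials S. superintegrable_hamiltonian (dom S) (metric S) (killing S) V)"

text \<open>The linear span of the trace-free parts of the Killing tensors, as contravariant tensor fields
  on the domain. The span is written out because the type of tensor fields is a function type.\<close>

definition tracefree_span :: "('n::finite) system \<Rightarrow> 'n tensor2 set" where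
  "tracefree_span S = {T. \<exists>A c. finite A \<and> A \<subseteq> killing S \<and>
     (\<forall>x \<in> dom S. T x = (\<Sum>K\<in>A. c K *\<^sub>R tracefree_part (metric S) (raise (metric S) K) x))}"

text \<open>$\tilde H = \Omega^{-2} H$ on phase space.\<close>

definition rescaled_hamiltonian ::
  "(real^'n::finite) set \<Rightarrow> (real^'n \<Rightarrow> real) \<Rightarrow>
   (real^'n \<Rightarrow> real^'n \<Rightarrow> real) \<Rightarrow> (real^'n \<Rightarrow> real^'n \<Rightarrow> real) \<Rightarrow> bool" where
  "rescaled_hamiltonian U \<Omega> H H' \<longleftrightarrow> (\<forall>x\<in>U. \<forall>p. H' x p = H x p / (\<Omega> x)\<^sup>2)"

text \<open>Since a system carries a whole space of potentials, the same \<open>\<Omega>\<close> has to relate the two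
  families of Hamiltonians.\<close>

definition conformally_equivalent :: "('n::finite) system \<Rightarrow> 'n system \<Rightarrow> bool" where
  "conformally_equivalent S S' \<longleftrightarrow>
     dom S' = dom S \<and>
     (\<exists>\<Omega>. smooth_on (dom S) \<Omega> \<and> (\<forall>x \<in> dom S. \<Omega> x \<noteq> 0) \<and>
        (\<forall>V \<in> potentials S. \<exists>V' \<in> potentials S'.
           rescaled_hamiltonian (dom S) \<Omega> (hamiltonian (metric S) V) (hamiltonian (metric S') V')) \<and>
        (\<forall>V' \<in> potentials S'. \<exists>V \<in> potentials S.
           rescaled_hamiltonian (dom S) \<Omega> (hamiltonian (metric S) V) (hamiltonian (metric S') V'))) \<and>
     tracefree_span S' = tracefree_span S"

section \<open>The generic system on the sphere\<close>

text \<open>The angles \<open>\<phi> $ m\<close> are indexed by a finite linearly ordered type, so that \<open>k < m\<close> ranges over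
  the preceding angles. The sphere is parametrized by
  $x_m = \cos\phi_m \prod_{k<m}\sin\phi_k$ together with $x_{n+1} = \prod_k \sin\phi_k$, and the
  potential is $a_0 + \sum_m a_m x_m^{-2} + a_{n+1} x_{n+1}^{-2}$.\<close>

definition sphere_metric :: "('n::{finite,linorder}) tensor2" where
  "sphere_metric \<phi> =
     (\<chi> i j. if i = j then (\<Prod>k\<in>{k. k < i}. (sin (\<phi> $ k))\<^sup>2) else 0)"

definition generic_potential ::
  "real \<Rightarrow> ('n \<Rightarrow> real) \<Rightarrow> real \<Rightarrow> real^'n::{finite,linorder} \<Rightarrow> real" where
  "generic_potential a0 a b \<phi> =
     a0 + (\<Sum>m\<in>UNIV. a m / ((cos (\<phi> $ m))\<^sup>2 * (\<Prod>k\<in>{k. k < m}. (sin (\<phi> $ k))\<^sup>2)))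
        + b / (\<Prod>k\<in>UNIV. (sin (\<phi> $ k))\<^sup>2)"

text \<open>The points where the coordinates and all the potentials are regular, i.e. where no ambient
  coordinate vanishes.\<close>

definition sphere_domain :: "(real^'n::{finite,linorder}) set" where
  "sphere_domain = {\<phi>. \<forall>k. sin (\<phi> $ k) \<noteq> 0 \<and> cos (\<phi> $ k) \<noteq> 0}"

definition generic_potentials :: "(real^'n::{finite,linorder}) set \<Rightarrow> (real^'n::{finite,linorder} \<Rightarrow> real) set" where
  "generic_potentials U = {V. \<exists>a0 a b. \<forall>\<phi>\<in>U. V \<phi> = generic_potential a0 a b \<phi>}"

definition generic_sphere_system :: "(real^'n::{finite,linorder}) set \<Rightarrow> 'n system" where
  "generic_sphere_system U =
     \<lparr> dom = U,
       metric = sphere_metric,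
       potentials = generic_potentials U,
       killing = compatible_killing_tensors U sphere_metric (generic_potentials U) \<rparr>"

end

theory Submission
  imports Defs
begin

text \<open>
  Every constant function is a compatible potential, so a properly superintegrable flat system
  contains the potential $1$. Conformal equivalence pulls it back to a potential $V = \Omega^2$ of
  the generic family. The question is therefore purely geometric: can the round metric become flat
  after multiplication by some
  $F = a_0 + \sum_m a_m x_m^{-2} + a_{n+1} x_{n+1}^{-2}$? For $n \geq 3$ it cannot
  (\<open>generic_factor_not_flat\<close>).

  Let $i < j < k$ be the first three angles. The potential is nested,
  \[ F = a_0 + \frac{a_i}{\cos^2\phi_i} + \frac{T_1}{\sin^2\phi_i}, \quad
     T_1 = \frac{a_j}{\cos^2\phi_j} + \frac{T_2}{\sin^2\phi_j}, \quad
     T_2 = \frac{a_k}{\cos^2\phi_k} + \frac{T_3}{\sin^2\phi_k}, \]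
  where $T_1, T_2, T_3$ depend only on the angles after $i$, $j$, $k$ respectively. The conformal
  metric is diagonal, and two kinds of curvature components suffice.

  The components $R^l{}_{qlp}$ with three distinct indices and $p < q$ involve $F$ through mixed
  derivatives only. When $F = P + R / \sin^2\phi_p$ with $P$ independent of $\phi_q$ and $R$
  independent of $\phi_p$, their vanishing becomes
  $\partial_q R \, (2 \cot\phi_p \, P + \partial_p P) = 0$ (\<open>mixed_equation_split\<close>). For
  $(p, q) = (i, j)$ this says that where $a_0 + a_i / \cos^4\phi_i$ does not vanish,
  $a_j \tan^4\phi_j = T_2$; the two sides depend on different angles, so both vanish and $F$ is a
  function of $\phi_i$ alone. For $(p, q) = (j, k)$ and $a_0 = a_i = 0$ it says likewise that either
  $a_j = 0$ or $F$ reduces to the single term with coefficient $a_j$.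

  The component $R^i{}_{jij}$, with $\upsilon_m = \partial_m \log \sqrt F$, gives
  $\partial_j \upsilon_j + t = \sin^2\phi_i \, (1 - \partial_i\upsilon_i - \cot\phi_i \,\upsilon_i)$
  with some $t \geq 0$ (\<open>sectional_equation\<close>). If $F$ is a function of $\phi_i$ alone, this is an
  ordinary differential equation, and $a_0 + a_i / \cos^2\phi_i$ solves it only if it vanishes. If
  $a_0 = a_i = 0$, then $F$ is $1/\sin^2\phi_i$ times a function of the other angles and the right-hand
  side is zero, whereas $\partial_j\upsilon_j$ is $1/\sin^2\phi_j$ or $1/\cos^2\phi_j$: the curvature
  is strictly negative.
\<close>

section \<open>Calculus of partial derivatives\<close>

text \<open>
  The predicate bundles differentiability with the value of the partial derivative. The rules below
  have the value as an equation in the premises, in the style of \<open>derivative_eq_intros\<close>, so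
  that a derivative is computed by resolution and a final algebraic check.
\<close>

definition has_pd :: "(real^'n::finite \<Rightarrow> real) \<Rightarrow> 'n \<Rightarrow> real \<Rightarrow> real^'n \<Rightarrow> bool" where
  "has_pd f i d x \<longleftrightarrow> f differentiable (at x) \<and> pd i f x = d"

lemma has_pd_iff:
  "has_pd f i d x \<longleftrightarrow> (\<exists>f'. (f has_derivative f') (at x) \<and> f' (axis i 1) = d)"
  unfolding has_pd_def pd_def differentiable_def
  by (metis frechet_derivative_at)

lemma has_pdI: "f differentiable (at x) \<Longrightarrow> has_pd f i (pd i f x) x"
  by (simp add: has_pd_def)

lemma has_pd_pd: "has_pd f i d x \<Longrightarrow> pd i f x = d"
  by (simp add: has_pd_def)

lemma has_pd_differentiable: "has_pd f i d x \<Longrightarrow> f differentiable (at x)"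
  by (simp add: has_pd_def)

lemma has_pd_unique: "has_pd f i d x \<Longrightarrow> has_pd f i e x \<Longrightarrow> d = e"
  by (simp add: has_pd_def)

lemma has_pd_const: "0 = d \<Longrightarrow> has_pd (\<lambda>y. c) i d x"
  unfolding has_pd_iff by (intro exI[of _ "\<lambda>_. 0"]) auto

lemma has_pd_coord: "(if i = k then 1 else 0) = d \<Longrightarrow> has_pd (\<lambda>y. y $ k) i d x"
  unfolding has_pd_iff
  by (intro exI[of _ "\<lambda>y. y $ k"])
     (auto simp: axis_def intro: bounded_linear_imp_has_derivative bounded_linear_vec_nth)

lemma has_pd_add:
  "has_pd f i a x \<Longrightarrow> has_pd g i b x \<Longrightarrow> a + b = d \<Longrightarrow> has_pd (\<lambda>y. f y + g y) i d x"
  unfolding has_pd_iff by (fastforce intro: has_derivative_add)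

lemma has_pd_diff:
  "has_pd f i a x \<Longrightarrow> has_pd g i b x \<Longrightarrow> a - b = d \<Longrightarrow> has_pd (\<lambda>y. f y - g y) i d x"
  unfolding has_pd_iff by (fastforce intro: has_derivative_diff)

lemma has_pd_mult:
  "has_pd f i a x \<Longrightarrow> has_pd g i b x \<Longrightarrow> f x * b + a * g x = d \<Longrightarrow> has_pd (\<lambda>y. f y * g y) i d x"
  unfolding has_pd_iff
  apply clarify
  subgoal for f' g'
    by (intro exI[of _ "\<lambda>h. f x * g' h + f' h * g x"]) (simp add: has_derivative_mult)
  done

lemma has_pd_chain:
  assumes "(\<phi> has_real_derivative e) (at (f x))" "has_pd f i a x" "e * a = d"
  shows "has_pd (\<lambda>y. \<phi> (f y)) i d x"
proof -
  obtain f' where f': "(f has_derivative f') (at x)" "f' (axis i 1) = a"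
    using assms(2) has_pd_iff by blast
  have "((\<lambda>y. \<phi> (f y)) has_derivative (\<lambda>h. e * f' h)) (at x)"
    using has_derivative_compose[OF f'(1), of \<phi> "\<lambda>h. e * h"] assms(1)
    by (simp add: has_field_derivative_def)
  then show ?thesis using f' assms(3) has_pd_iff by blast
qed

lemma has_pd_sin: "has_pd f i a x \<Longrightarrow> cos (f x) * a = d \<Longrightarrow> has_pd (\<lambda>y. sin (f y)) i d x"
  by (rule has_pd_chain) (auto intro: DERIV_sin)

lemma has_pd_cos: "has_pd f i a x \<Longrightarrow> - sin (f x) * a = d \<Longrightarrow> has_pd (\<lambda>y. cos (f y)) i d x"
  by (rule has_pd_chain) (auto intro: DERIV_cos)

lemma has_pd_power:
  "has_pd f i a x \<Longrightarrow> real n * f x ^ (n - 1) * a = d \<Longrightarrow> has_pd (\<lambda>y. f y ^ n) i d x"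
  by (rule has_pd_chain[where \<phi> = "\<lambda>z. z ^ n"]) (auto intro!: derivative_eq_intros)

lemma has_pd_inverse:
  "has_pd f i a x \<Longrightarrow> f x \<noteq> 0 \<Longrightarrow> - a / (f x)\<^sup>2 = d \<Longrightarrow> has_pd (\<lambda>y. inverse (f y)) i d x"
  by (rule has_pd_chain) (auto intro!: derivative_eq_intros simp: power2_eq_square field_simps)

lemma has_pd_divide:
  assumes "has_pd f i a x" "has_pd g i b x" "g x \<noteq> 0" "a / g x - f x * b / (g x)\<^sup>2 = d"
  shows "has_pd (\<lambda>y. f y / g y) i d x"
  unfolding divide_inverse
  by (rule has_pd_mult[OF assms(1) has_pd_inverse[OF assms(2,3) refl]])
     (use assms(3,4) in \<open>simp add: field_simps\<close>)

lemmas has_pd_intros = has_pd_const has_pd_coord has_pd_add has_pd_diff has_pd_mult has_pd_divide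
  has_pd_sin has_pd_cos has_pd_power

lemma has_pd_eq_on_open:
  assumes "open U" "x \<in> U" "\<And>y. y \<in> U \<Longrightarrow> f y = g y"
  shows "has_pd f i d x \<longleftrightarrow> has_pd g i d x"
  unfolding has_pd_iff
  using has_derivative_transform_within_open[of f _ x UNIV U g]
    has_derivative_transform_within_open[of g _ x UNIV U f] assms by auto

text \<open>
  Unlike the previous lemma, this holds for functions that are not known to be differentiable:
  the Frechet derivative is a description operator applied to the same predicate on both sides.
\<close>

lemma pd_eq_on_open:
  assumes "open U" "x \<in> U" "\<And>y. y \<in> U \<Longrightarrow> f y = g y"
  shows "pd i f x = pd i g x"
proof -
  have "\<And>f'. (f has_derivative f') (at x) \<longleftrightarrow> (g has_derivative f') (at x)"
    using has_derivative_transform_within_open[of f _ x UNIV U g]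
      has_derivative_transform_within_open[of g _ x UNIV U f] assms by auto
  then show ?thesis by (simp add: pd_def frechet_derivative_def)
qed

lemma has_pd_independent:
  assumes "f differentiable (at x)" "\<And>t. f (x + t *\<^sub>R axis i 1) = f x"
  shows "has_pd f i 0 x"
proof -
  obtain f' where f': "(f has_derivative f') (at x)" using assms(1) differentiable_def by blast
  have lin: "linear f'" using f' has_derivative_linear by blast
  have 1: "((\<lambda>t::real. x + t *\<^sub>R axis i 1) has_derivative (\<lambda>t. t *\<^sub>R axis i 1)) (at 0)"
    by (auto intro!: derivative_eq_intros)
  have "((\<lambda>t::real. f (x + t *\<^sub>R axis i 1)) has_derivative (\<lambda>t. f' (t *\<^sub>R axis i 1))) (at 0)"
    using has_derivative_compose[OF 1, of f f'] f' by simp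
  moreover have "((\<lambda>t::real. f (x + t *\<^sub>R axis i 1)) has_derivative (\<lambda>t. 0)) (at 0)"
    unfolding assms(2) by (rule has_derivative_const)
  ultimately have "(\<lambda>t. f' (t *\<^sub>R axis i 1)) = (\<lambda>t. 0)"
    by (rule has_derivative_unique)
  then have "f' (1 *\<^sub>R axis i 1) = 0" by metis
  then show ?thesis unfolding has_pd_iff using f' by auto
qed

lemma has_pd_prod_sin:
  assumes "finite A" "\<And>k. k \<in> A \<Longrightarrow> sin (x $ k) \<noteq> 0"
  shows "has_pd (\<lambda>y. \<Prod>k\<in>A. (sin (y $ k))\<^sup>2) i
    (if i \<in> A then 2 * (cos (x $ i) / sin (x $ i)) * (\<Prod>k\<in>A. (sin (x $ k))\<^sup>2) else 0) x"
  using assms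
proof (induction A rule: finite_induct)
  case empty
  then show ?case by (simp add: has_pd_const)
next
  case (insert m A)
  have IH: "has_pd (\<lambda>y. \<Prod>k\<in>A. (sin (y $ k))\<^sup>2) i
    (if i \<in> A then 2 * (cos (x $ i) / sin (x $ i)) * (\<Prod>k\<in>A. (sin (x $ k))\<^sup>2) else 0) x"
    using insert by auto
  have m: "has_pd (\<lambda>y. (sin (y $ m))\<^sup>2) i
      (if i = m then 2 * sin (x $ m) * cos (x $ m) else 0) x"
    by (rule has_pd_intros refl)+ simp
  have nz: "sin (x $ m) \<noteq> 0" using insert by auto
  show ?case unfolding prod.insert[OF insert(1,2)]
    by (rule has_pd_mult[OF m IH]) (use insert(2) nz in \<open>auto simp: power2_eq_square\<close>)
qed

section \<open>Curvature of diagonal metrics\<close>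

lemma matrix_inv_diagonal:
  fixes A :: "real^'n::finite^'n"
  assumes A: "\<And>a b. A $ a $ b = (if a = b then d a else 0)" and d: "\<And>a. d a \<noteq> 0"
  shows "matrix_inv A $ a $ b = (if a = b then 1 / d a else 0)"
proof -
  define B :: "real^'n^'n" where "B = (\<chi> a b. if a = b then 1 / d a else 0)"
  have AB: "A ** B = mat 1" and BA: "B ** A = mat 1"
    by (auto simp: matrix_matrix_mult_def vec_eq_iff A B_def mat_def d if_distrib[of "\<lambda>z. z * _"]
        cong: if_cong)
  have "A ** matrix_inv A = mat 1 \<and> matrix_inv A ** A = mat 1"
    unfolding matrix_inv_def by (rule someI_ex) (use AB BA in blast)
  then have "matrix_inv A = B"
    by (metis BA matrix_mul_assoc matrix_mul_lid matrix_mul_rid)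
  then show ?thesis by (simp add: B_def)
qed

text \<open>
  This is $\partial_a \log\sqrt{|h_b|}$. In these terms the Christoffel symbols of a diagonal metric
  carry no factors other than the ratios $h_i / h_l$.
\<close>

definition half_dlog :: "('n \<Rightarrow> real^'n::finite \<Rightarrow> real) \<Rightarrow> 'n \<Rightarrow> 'n \<Rightarrow> real^'n \<Rightarrow> real" where
  "half_dlog h a b x = pd a (h b) x / (2 * h b x)"

locale diagonal_metric =
  fixes U :: "(real^'n::finite) set" and g :: "'n tensor2" and h :: "'n \<Rightarrow> real^'n \<Rightarrow> real"
  assumes open_U: "open U"
    and g_eq: "\<And>x a b. x \<in> U \<Longrightarrow> g x $ a $ b = (if a = b then h a x else 0)"
    and h_nz: "\<And>x a. x \<in> U \<Longrightarrow> h a x \<noteq> 0"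
begin

abbreviation D where "D \<equiv> half_dlog h"

lemma inv_eq: "x \<in> U \<Longrightarrow> matrix_inv (g x) $ a $ b = (if a = b then 1 / h a x else 0)"
  by (rule matrix_inv_diagonal) (auto simp: g_eq h_nz)

lemma pd_g: "x \<in> U \<Longrightarrow> pd i (\<lambda>y. g y $ a $ b) x = (if a = b then pd i (h a) x else 0)"
proof -
  assume x: "x \<in> U"
  have "pd i (\<lambda>y. g y $ a $ b) x = pd i (if a = b then h a else (\<lambda>_. 0)) x"
    by (rule pd_eq_on_open[OF open_U x]) (auto simp: g_eq)
  then show ?thesis by (auto intro: has_pd_pd has_pd_const)
qed

lemma christoffel_eq:
  assumes x: "x \<in> U"
  shows "christoffel g l i j x =
    (if j = l then D i l x else 0) + (if i = l then D j l x else 0)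
    - (if i = j then h i x / h l x * D l i x else 0)"
proof -
  have "christoffel g l i j x = (pd i (\<lambda>y. g y $ j $ l) x + pd j (\<lambda>y. g y $ i $ l) x
      - pd l (\<lambda>y. g y $ i $ j) x) / (2 * h l x)"
    unfolding christoffel_def inv_eq[OF x] by (simp add: if_distrib[of "\<lambda>z. z * _"] cong: if_cong)
  then show ?thesis using h_nz[OF x]
    by (auto simp: pd_g[OF x] half_dlog_def diff_divide_distrib add_divide_distrib)
qed

lemma pd_christoffel:
  assumes "x \<in> U"
  shows "pd a (christoffel g l i j) x = pd a (\<lambda>x. (if j = l then D i l x else 0)
     + (if i = l then D j l x else 0) - (if i = j then h i x / h l x * D l i x else 0)) x"
  by (rule pd_eq_on_open[OF open_U assms]) (simp add: christoffel_eq)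

text \<open>
  A Christoffel symbol of a diagonal metric vanishes when its indices are distinct, so only three
  terms of the quadratic sum survive.
\<close>

lemma riemann_mixed:
  assumes x: "x \<in> U" and ijk: "i \<noteq> j" "i \<noteq> k" "j \<noteq> k"
  shows "riemann g i k i j x =
    - pd j (D k i) x + D j i x * D k j x + D k i x * D j k x - D j i x * D k i x"
proof -
  have s: "(\<Sum>m\<in>UNIV. christoffel g i i m x * christoffel g m j k x
        - christoffel g i j m x * christoffel g m i k x)
     = (\<Sum>m\<in>{i,j,k}. christoffel g i i m x * christoffel g m j k x
        - christoffel g i j m x * christoffel g m i k x)"
    by (rule sum.mono_neutral_right) (use ijk in \<open>auto simp: christoffel_eq[OF x]\<close>)
  show ?thesis unfolding riemann_def s pd_christoffel[OF x]
    using ijk h_nz[OF x] by (simp add: christoffel_eq[OF x] has_pd_pd[OF has_pd_const[OF refl]])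
qed

text \<open>
  Here the quadratic sum runs over all indices; the part outside $\{i, j\}$ is kept as a sum because
  for the first two angles of a conformally spherical metric each of its terms has a sign.
\<close>

lemma riemann_sectional:
  assumes x: "x \<in> U" and ij: "i \<noteq> j"
  shows "riemann g i j i j x =
    pd i (\<lambda>y. - (h j y / h i y * D i j y)) x - pd j (D j i) x
    - h j x / h i x * D i i x * D i j x + D j i x * D j j x - (D j i x)\<^sup>2
    + h j x / h i x * (D i j x)\<^sup>2
    - (\<Sum>m\<in>UNIV - {i, j}. h j x / h m x * D m i x * D m j x)"
proof -
  have s: "(\<Sum>m\<in>UNIV. christoffel g i i m x * christoffel g m j j x
        - christoffel g i j m x * christoffel g m i j x)
     = (\<Sum>m\<in>{i,j}. christoffel g i i m x * christoffel g m j j x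
        - christoffel g i j m x * christoffel g m i j x)
     + (\<Sum>m\<in>UNIV-{i,j}. - (h j x / h m x * D m i x * D m j x))"
  proof -
    have "(\<Sum>m\<in>UNIV-{i,j}. - (h j x / h m x * D m i x * D m j x)) =
      (\<Sum>m\<in>UNIV-{i,j}. christoffel g i i m x * christoffel g m j j x
        - christoffel g i j m x * christoffel g m i j x)"
      by (rule sum.cong) (auto simp: christoffel_eq[OF x] ij ij[symmetric])
    then show ?thesis by (subst sum.subset_diff[of "{i,j}"]) auto
  qed
  show ?thesis unfolding riemann_def s pd_christoffel[OF x] sum_negf
    using ij h_nz[OF x] by (simp add: christoffel_eq[OF x] power2_eq_square algebra_simps)
qed

end

section \<open>Conformally spherical metrics\<close>

locale conformally_spherical =
  fixes U :: "(real^'n::{finite,linorder}) set" and F :: "real^'n::{finite,linorder} \<Rightarrow> real" and g :: "'n::{finite,linorder} tensor2"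
  assumes open_U: "open U" and U_dom: "U \<subseteq> sphere_domain"
    and g_eq: "\<And>x. x \<in> U \<Longrightarrow> g x = F x *\<^sub>R sphere_metric x"
    and F_pos: "\<And>x. x \<in> U \<Longrightarrow> F x > 0"
    and F_diff: "\<And>x. x \<in> U \<Longrightarrow> F differentiable (at x)"
    and pd_F_diff: "\<And>x k. x \<in> U \<Longrightarrow> pd k F differentiable (at x)"
begin

lemma sin_nz [simp]: "x \<in> U \<Longrightarrow> sin (x $ k) \<noteq> 0" and cos_nz [simp]: "x \<in> U \<Longrightarrow> cos (x $ k) \<noteq> 0"
  using U_dom by (auto simp: sphere_domain_def)

definition h where
  "h a x = F x * (\<Prod>k\<in>{k. k < a}. (sin (x $ k))\<^sup>2)"

text \<open>
  The logarithmic derivative of the conformal factor $\Omega = \sqrt F$.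
\<close>

definition \<upsilon> where
  "\<upsilon> a x = pd a F x / (2 * F x)"

lemma F_nz [simp]: "x \<in> U \<Longrightarrow> F x \<noteq> 0"
  using F_pos by force

lemma h_pos: "x \<in> U \<Longrightarrow> h a x > 0"
  unfolding h_def by (auto intro!: mult_pos_pos F_pos prod_pos)

sublocale diagonal_metric U g h
proof
  show "open U" by (rule open_U)
  fix x a b assume x: "x \<in> U"
  show "g x $ a $ b = (if a = b then h a x else 0)"
    by (simp add: g_eq[OF x] sphere_metric_def h_def)
  show "h a x \<noteq> 0" using h_pos[OF x, of a] by simp
qed

lemma D_eq:
  assumes x: "x \<in> U"
  shows "D a b x = \<upsilon> a x + (if a < b then cos (x $ a) / sin (x $ a) else 0)"
proof -
  have "has_pd (h b) a (F x * (if a \<in> {k. k < b} then 2 * (cos (x $ a) / sin (x $ a)) *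
      (\<Prod>k\<in>{k. k < b}. (sin (x $ k))\<^sup>2) else 0)
    + pd a F x * (\<Prod>k\<in>{k. k < b}. (sin (x $ k))\<^sup>2)) x"
    unfolding h_def
    by (rule has_pd_mult[OF has_pdI[OF F_diff[OF x]] has_pd_prod_sin refl]) (use x in auto)
  from has_pd_pd[OF this] show ?thesis
    using x h_pos[OF x, of b]
    by (auto simp: half_dlog_def \<upsilon>_def h_def field_simps)
qed

lemma has_pd_\<upsilon>:
  assumes x: "x \<in> U"
  shows "has_pd (\<upsilon> a) i (pd i (\<upsilon> a) x) x"
proof -
  have "has_pd (\<lambda>y. pd a F y / (2 * F y)) i (pd i (pd a F) x / (2 * F x)
      - pd a F x * (2 * pd i F x + 0 * F x) / (2 * F x)\<^sup>2) x"
    by (rule has_pd_divide[OF has_pdI has_pd_mult[OF has_pd_const has_pdI]])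
       (use x F_diff pd_F_diff in auto)
  then have "(\<lambda>y. pd a F y / (2 * F y)) differentiable (at x)" by (rule has_pd_differentiable)
  then show ?thesis unfolding \<upsilon>_def[abs_def] by (rule has_pdI)
qed

text \<open>
  With $u = F^{-1/2}$ this is $\partial_j\partial_k u = \cot\phi_j\,\partial_k u$, an off-diagonal
  component of the condition that the Hessian of $u$ on the sphere be pure trace. The third index
  $i$ cancels from the result, but has to exist.
\<close>

lemma mixed_equation:
  assumes x: "x \<in> U" and flat: "flat_on U g" and ijk: "i \<noteq> j" "i \<noteq> k" "j < k"
  shows "pd j (\<upsilon> k) x = (\<upsilon> j x + cos (x $ j) / sin (x $ j)) * \<upsilon> k x"
proof -
  have cot: "has_pd (\<lambda>y. cos (y $ k) / sin (y $ k)) j 0 x" "has_pd (\<lambda>y. 0) j 0 x"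
    using ijk x by (auto intro!: has_pd_divide has_pd_cos has_pd_sin has_pd_coord has_pd_const)
  have "has_pd (\<lambda>y. \<upsilon> k y + (if k < i then cos (y $ k) / sin (y $ k) else 0)) j
    (pd j (\<upsilon> k) x) x"
    by (rule has_pd_add[OF has_pd_\<upsilon>[OF x], where b = 0])
       (use ijk cot in \<open>cases "k < i"; simp\<close>)+
  also have "?this \<longleftrightarrow> has_pd (D k i) j (pd j (\<upsilon> k) x) x"
    by (rule has_pd_eq_on_open[OF open_U x]) (simp add: D_eq)
  finally have 1: "pd j (D k i) x = pd j (\<upsilon> k) x" by (rule has_pd_pd)
  have "riemann g i k i j x = 0" using flat x by (simp add: flat_on_def)
  with riemann_mixed[OF x ijk(1,2)] 1 ijk
  show ?thesis
    by (cases "k < i"; cases "j < i") (auto simp: D_eq[OF x] algebra_simps)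
qed

text \<open>
  For the first two angles $h_j / h_i = \sin^2\phi_i$, and for every other index $m$ both logarithmic
  derivatives in the remaining sum equal $\upsilon_m$. So $t$ is a combination of the squares
  $\upsilon_m^2$ with positive coefficients, and only its sign will matter.
\<close>

lemma sectional_equation:
  assumes x: "x \<in> U" and flat: "flat_on U g"
    and ij: "i < j" and i_least: "\<And>m. i \<le> m" and j_least: "\<And>m. m \<noteq> i \<Longrightarrow> j \<le> m"
  obtains t where "t \<ge> 0" "(\<And>m. m \<noteq> i \<Longrightarrow> m \<noteq> j \<Longrightarrow> \<upsilon> m x = 0) \<Longrightarrow> t = 0"
    "pd j (\<upsilon> j) x + t =
      (sin (x $ i))\<^sup>2 * (1 - pd i (\<upsilon> i) x - cos (x $ i) / sin (x $ i) * \<upsilon> i x)"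
proof
  define t where "t = (\<Sum>m\<in>UNIV - {i, j}. h j x / h m x * (\<upsilon> m x)\<^sup>2)"
  show "t \<ge> 0" unfolding t_def using h_pos[OF x] by (auto intro!: sum_nonneg simp: less_imp_le)
  show "(\<And>m. m \<noteq> i \<Longrightarrow> m \<noteq> j \<Longrightarrow> \<upsilon> m x = 0) \<Longrightarrow> t = 0" unfolding t_def by (auto intro!: sum.neutral)
  have below: "{k. k < i} = {}" "{k. k < j} = {i}"
    using i_least j_least ij by (auto simp: not_less) (metis leD)
  have ratio: "h j y / h i y = (sin (y $ i))\<^sup>2" if "y \<in> U" for y
    using that by (simp add: h_def below)
  have nless: "\<not> m < i" "m < j \<longleftrightarrow> m = i" for m
    using below by auto
  have "has_pd (\<lambda>y. - 1 * ((sin (y $ i))\<^sup>2 * (\<upsilon> i y + cos (y $ i) / sin (y $ i)))) i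
     (- (sin (x $ i))\<^sup>2 * pd i (\<upsilon> i) x - 2 * sin (x $ i) * cos (x $ i) * \<upsilon> i x
       - (cos (x $ i))\<^sup>2 + (sin (x $ i))\<^sup>2) x"
    apply ((rule has_pd_intros has_pd_\<upsilon>[OF x] refl)+ | (simp add: sin_nz[OF x]; fail))+
    using x by (simp add: field_simps power2_eq_square) (use sin_cos_squared_add3[of "x $ i"] in algebra)
  also have "?this \<longleftrightarrow> has_pd (\<lambda>y. - (h j y / h i y * D i j y)) i
     (- (sin (x $ i))\<^sup>2 * pd i (\<upsilon> i) x - 2 * sin (x $ i) * cos (x $ i) * \<upsilon> i x
       - (cos (x $ i))\<^sup>2 + (sin (x $ i))\<^sup>2) x"
    by (rule has_pd_eq_on_open[OF open_U x]) (simp add: ratio D_eq nless)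
  finally have 1: "pd i (\<lambda>y. - (h j y / h i y * D i j y)) x =
     - (sin (x $ i))\<^sup>2 * pd i (\<upsilon> i) x - 2 * sin (x $ i) * cos (x $ i) * \<upsilon> i x
       - (cos (x $ i))\<^sup>2 + (sin (x $ i))\<^sup>2" by (rule has_pd_pd)
  have 2: "pd j (D j i) x = pd j (\<upsilon> j) x"
    by (rule pd_eq_on_open[OF open_U x]) (simp add: D_eq nless)
  have 3: "(\<Sum>m\<in>UNIV - {i, j}. h j x / h m x * D m i x * D m j x) = t"
    unfolding t_def by (rule sum.cong) (auto simp: D_eq[OF x] nless power2_eq_square)
  have "riemann g i j i j x = 0" using flat x by (simp add: flat_on_def)
  moreover have "D i i x = \<upsilon> i x" "D i j x = \<upsilon> i x + cos (x $ i) / sin (x $ i)"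
    "D j i x = \<upsilon> j x" "D j j x = \<upsilon> j x"
    by (auto simp: D_eq[OF x] nless)
  ultimately have "0 = - (sin (x $ i))\<^sup>2 * pd i (\<upsilon> i) x - 2 * sin (x $ i) * cos (x $ i) * \<upsilon> i x
       - (cos (x $ i))\<^sup>2 + (sin (x $ i))\<^sup>2 - pd j (\<upsilon> j) x
       - (sin (x $ i))\<^sup>2 * \<upsilon> i x * (\<upsilon> i x + cos (x $ i) / sin (x $ i))
       + (sin (x $ i))\<^sup>2 * (\<upsilon> i x + cos (x $ i) / sin (x $ i))\<^sup>2 - t"
    using riemann_sectional[OF x, of i j] ij unfolding 1 2 3 ratio[OF x]
    by (simp add: power2_eq_square)
  moreover have "sin (x $ i) * (cos (x $ i) / sin (x $ i)) = cos (x $ i)"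
    using x by simp
  ultimately show "pd j (\<upsilon> j) x + t =
      (sin (x $ i))\<^sup>2 * (1 - pd i (\<upsilon> i) x - cos (x $ i) / sin (x $ i) * \<upsilon> i x)"
    by algebra
qed

text \<open>
  Since $P$ does not contribute to $\partial_k F$, the mixed equation factorizes: it becomes
  $\partial_k R \,(2\cot\phi_j\,F + \partial_j F) = 0$, and in the second factor the contributions of
  $R / \sin^2\phi_j$ cancel.
\<close>

lemma mixed_equation_split:
  assumes x: "x \<in> U" and flat: "flat_on U g" and ijk: "i \<noteq> j" "i \<noteq> k" "j < k"
    and F_eq: "\<And>y. y \<in> U \<Longrightarrow> F y = P y + R y / (sin (y $ j))\<^sup>2"
    and P: "\<And>y. y \<in> U \<Longrightarrow> has_pd P k 0 y" "has_pd P j P' x"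
    and R: "\<And>y. y \<in> U \<Longrightarrow> has_pd R k (R' y) y" "has_pd R j 0 x" "has_pd R' j 0 x"
  shows "R' x * (2 * cos (x $ j) / sin (x $ j) * P x + P') = 0"
proof -
  have Fk: "pd k F y = R' y / (sin (y $ j))\<^sup>2" if y: "y \<in> U" for y
  proof -
    have "has_pd (\<lambda>y. P y + R y / (sin (y $ j))\<^sup>2) k (R' y / (sin (y $ j))\<^sup>2) y"
      apply ((rule P(1) R(1) y has_pd_intros refl)+ | (simp add: sin_nz[OF y]; fail))+
      using ijk y by simp
    also have "?this \<longleftrightarrow> has_pd F k (R' y / (sin (y $ j))\<^sup>2) y"
      by (rule has_pd_eq_on_open[OF open_U y]) (simp add: F_eq)
    finally show ?thesis by (rule has_pd_pd)
  qed
  let ?s = "sin (x $ j)" and ?c = "cos (x $ j)"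
  have "has_pd (\<lambda>y. P y + R y / (sin (y $ j))\<^sup>2) j (P' - 2 * R x * ?c / ?s ^ 3) x"
    apply ((rule P(2) R(2) has_pd_intros refl)+ | (simp add: sin_nz[OF x]; fail))+
    using x by (simp add: field_simps power2_eq_square power3_eq_cube)
  also have "?this \<longleftrightarrow> has_pd F j (P' - 2 * R x * ?c / ?s ^ 3) x"
    by (rule has_pd_eq_on_open[OF open_U x]) (simp add: F_eq)
  finally have Fj: "has_pd F j (P' - 2 * R x * ?c / ?s ^ 3) x" .
  have "has_pd (\<lambda>y. R' y / (sin (y $ j))\<^sup>2 / (2 * F y)) j
     (- R' x * ?c / (?s ^ 3 * F x) - R' x * pd j F x / (2 * ?s\<^sup>2 * (F x)\<^sup>2)) x"
    apply ((rule R(3) has_pdI[OF F_diff[OF x]] has_pd_intros refl)+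
        | (simp add: sin_nz[OF x] F_nz[OF x]; fail))+
    using x by (simp add: field_simps power2_eq_square power3_eq_cube)
  also have "?this \<longleftrightarrow> has_pd (\<upsilon> k) j
     (- R' x * ?c / (?s ^ 3 * F x) - R' x * pd j F x / (2 * ?s\<^sup>2 * (F x)\<^sup>2)) x"
    by (rule has_pd_eq_on_open[OF open_U x]) (simp add: Fk \<upsilon>_def)
  finally have "pd j (\<upsilon> k) x =
    - R' x * ?c / (?s ^ 3 * F x) - R' x * pd j F x / (2 * ?s\<^sup>2 * (F x)\<^sup>2)" by (rule has_pd_pd)
  with mixed_equation[OF x flat ijk]
  have "- R' x * ?c / (?s ^ 3 * F x) - R' x * pd j F x / (2 * ?s\<^sup>2 * (F x)\<^sup>2)
    = (pd j F x / (2 * F x) + ?c / ?s) * (R' x / ?s\<^sup>2 / (2 * F x))"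
    by (simp add: \<upsilon>_def Fk[OF x])
  then have "3 * (R' x * (2 * ?c * F x + ?s * pd j F x)) = 0"
    using sin_nz[OF x, of j] F_nz[OF x]
    by (simp add: divide_simps power2_eq_square power3_eq_cube) algebra
  moreover have "2 * ?c * F x + ?s * pd j F x = ?s * (2 * ?c / ?s * P x + P')"
    using sin_nz[OF x, of j]
    by (simp add: has_pd_pd[OF Fj] F_eq[OF x] field_simps power2_eq_square power3_eq_cube)
  ultimately show ?thesis using sin_nz[OF x, of j] by simp
qed

end

section \<open>The generic potential as a nested expression\<close>

text \<open>
  For a final segment $A$ of the angles this is the generic potential, without its constant, of the
  lower-dimensional sphere that these angles parametrize. Splitting off the least angle therefore
  unfolds the potential of the whole sphere from the outside.
\<close>

definition nested_potential ::
  "('n \<Rightarrow> real) \<Rightarrow> real \<Rightarrow> 'n set \<Rightarrow> real^'n::{finite,linorder} \<Rightarrow> real" where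
  "nested_potential a b A \<phi> =
     (\<Sum>m\<in>A. a m / ((cos (\<phi> $ m))\<^sup>2 * (\<Prod>k\<in>{k \<in> A. k < m}. (sin (\<phi> $ k))\<^sup>2)))
     + b / (\<Prod>k\<in>A. (sin (\<phi> $ k))\<^sup>2)"

lemma generic_potential_nested:
  "generic_potential a0 a b \<phi> = a0 + nested_potential a b UNIV \<phi>"
  by (simp add: generic_potential_def nested_potential_def)

lemma nested_potential_least:
  assumes k: "k \<in> A" "\<And>m. m \<in> A \<Longrightarrow> k \<le> m"
  shows "nested_potential a b A \<phi> =
    a k / (cos (\<phi> $ k))\<^sup>2 + nested_potential a b (A - {k}) \<phi> / (sin (\<phi> $ k))\<^sup>2"
proof -
  let ?s = "\<lambda>k. (sin (\<phi> $ k))\<^sup>2" and ?c = "\<lambda>k. (cos (\<phi> $ k))\<^sup>2"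
  have split: "A = insert k (A - {k})" using k by auto
  have below_k: "{l \<in> A. l < k} = {}" using k(2) by (auto simp: not_less)
  have below: "(\<Prod>l\<in>{l \<in> A. l < m}. ?s l) = ?s k * (\<Prod>l\<in>{l \<in> A - {k}. l < m}. ?s l)"
    if "m \<in> A - {k}" for m
  proof -
    have "{l \<in> A. l < m} = insert k {l \<in> A - {k}. l < m}"
      using k that by (auto simp: less_le)
    then show ?thesis by simp
  qed
  have "(\<Sum>m\<in>A. a m / (?c m * (\<Prod>l\<in>{l \<in> A. l < m}. ?s l))) =
    a k / ?c k + (\<Sum>m\<in>A - {k}. a m / (?c m * (\<Prod>l\<in>{l \<in> A. l < m}. ?s l)))"
    by (subst sum.remove[of A k]) (use k in \<open>simp_all add: below_k\<close>)
  also have "(\<Sum>m\<in>A - {k}. a m / (?c m * (\<Prod>l\<in>{l \<in> A. l < m}. ?s l)))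
    = (\<Sum>m\<in>A - {k}. a m / (?c m * (\<Prod>l\<in>{l \<in> A - {k}. l < m}. ?s l))) / ?s k"
    unfolding sum_divide_distrib
    by (rule sum.cong) (simp_all add: below mult_ac)
  finally have 1: "(\<Sum>m\<in>A. a m / (?c m * (\<Prod>l\<in>{l \<in> A. l < m}. ?s l))) = a k / ?c k
    + (\<Sum>m\<in>A - {k}. a m / (?c m * (\<Prod>l\<in>{l \<in> A - {k}. l < m}. ?s l))) / ?s k" .
  have 2: "(\<Prod>l\<in>A. ?s l) = ?s k * (\<Prod>l\<in>A - {k}. ?s l)"
    by (rule prod.remove) (use k in auto)
  show ?thesis unfolding nested_potential_def 1 2 by (simp add: add_divide_distrib mult_ac)
qed

lemma nested_potential_differentiable:
  assumes "x \<in> sphere_domain"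
  shows "nested_potential a b A differentiable (at x)"
proof -
  have [simp]: "sin (x $ k) \<noteq> 0" "cos (x $ k) \<noteq> 0" for k
    using assms by (auto simp: sphere_domain_def)
  have P: "(\<lambda>\<phi>. \<Prod>k\<in>B. (sin (\<phi> $ k))\<^sup>2) differentiable (at x)" for B :: "'a set"
    by (rule has_pd_differentiable[OF has_pd_prod_sin]) auto
  have C: "(\<lambda>\<phi>. (cos (\<phi> $ k))\<^sup>2) differentiable (at x)" for k
    by (rule has_pd_differentiable, (rule has_pd_intros refl)+)
  show ?thesis unfolding nested_potential_def[abs_def]
    by (intro differentiable_add differentiable_sum ballI differentiable_divide differentiable_mult
        P C differentiable_const) auto
qed

lemma nested_potential_cong:
  "(\<And>m. m \<in> A \<Longrightarrow> \<psi> $ m = \<phi> $ m) \<Longrightarrow> nested_potential a b A \<psi> = nested_potential a b A \<phi>"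
  unfolding nested_potential_def by (simp cong: sum.cong_simp prod.cong_simp)

lemma has_pd_nested_potential:
  assumes "x \<in> sphere_domain" "i \<notin> A"
  shows "has_pd (nested_potential a b A) i 0 x"
proof (rule has_pd_independent)
  show "nested_potential a b A differentiable (at x)"
    by (rule nested_potential_differentiable[OF assms(1)])
  show "nested_potential a b A (x + t *\<^sub>R axis i 1) = nested_potential a b A x" for t
    by (rule nested_potential_cong) (use assms(2) in \<open>auto simp: axis_def\<close>)
qed

text \<open>
  Differentiating with respect to the outermost angle compares $\alpha\tan^4\phi_k$ with the inner part
  $W$. This form lets a vanishing derivative separate the variables.
\<close>

lemma has_pd_outer_term:
  assumes x: "sin (x $ k) \<noteq> 0" "cos (x $ k) \<noteq> 0" and W: "has_pd W k 0 x"
  shows "has_pd (\<lambda>y. \<alpha> / (cos (y $ k))\<^sup>2 + W y / (sin (y $ k))\<^sup>2) k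
    (2 * cos (x $ k) / sin (x $ k) ^ 3 * (\<alpha> * (sin (x $ k) / cos (x $ k)) ^ 4 - W x)) x"
  apply ((rule W has_pd_intros refl)+ | (simp add: x; fail))+
  using x by (simp add: divide_simps) algebra

text \<open>
  Separation of variables: the right-hand side is independent of the coordinate $k$, while $f$
  depends on it to first order at every point.
\<close>

lemma independent_multiple_vanishes:
  assumes V: "open V" "V \<noteq> {}"
    and eq: "\<And>y. y \<in> V \<Longrightarrow> c * f y = W y"
    and W: "\<And>y. y \<in> V \<Longrightarrow> has_pd W k 0 y"
    and f: "\<And>y. y \<in> V \<Longrightarrow> has_pd f k (f' y) y" "\<And>y. y \<in> V \<Longrightarrow> f' y \<noteq> 0"
  shows "c = 0 \<and> (\<forall>y\<in>V. W y = 0)"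
proof -
  obtain x where x: "x \<in> V" using V by blast
  have "has_pd (\<lambda>y. c * f y) k (c * f' x) x"
    by (rule has_pd_mult[OF has_pd_const[OF refl] f(1)[OF x]]) simp
  also have "?this \<longleftrightarrow> has_pd W k (c * f' x) x"
    by (rule has_pd_eq_on_open[OF V(1) x]) (simp add: eq)
  finally have "c * f' x = 0" using W[OF x] has_pd_unique by blast
  then show ?thesis using f(2)[OF x] eq by auto
qed

lemma tan_power4_multiple_vanishes:
  fixes V :: "(real^'n::{finite,linorder}) set"
  assumes V: "open V" "V \<noteq> {}" "V \<subseteq> sphere_domain"
    and eq: "\<And>y. y \<in> V \<Longrightarrow> c * (sin (y $ k) / cos (y $ k)) ^ 4 = W y"
    and W: "\<And>y. y \<in> V \<Longrightarrow> has_pd W k 0 y"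
  shows "c = 0 \<and> (\<forall>y\<in>V. W y = 0)"
proof (rule independent_multiple_vanishes[OF V(1,2) eq W])
  fix y assume "y \<in> V"
  then have y: "sin (y $ k) \<noteq> 0" "cos (y $ k) \<noteq> 0" using V by (auto simp: sphere_domain_def)
  show "has_pd (\<lambda>y. (sin (y $ k) / cos (y $ k)) ^ 4) k
    (4 * sin (y $ k) ^ 3 / cos (y $ k) ^ 5) y"
    apply ((rule has_pd_intros refl)+ | (simp add: y; fail))+
    using y by (simp add: divide_simps) (use sin_cos_squared_add3[of "y $ k"] in algebra)
  show "4 * sin (y $ k) ^ 3 / cos (y $ k) ^ 5 \<noteq> 0" using y by simp
qed

lemma cos_power_multiple_vanishes:
  fixes V :: "(real^'n::{finite,linorder}) set"
  assumes V: "open V" "V \<noteq> {}" "V \<subseteq> sphere_domain" and n: "n > 0"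
    and eq: "\<And>y. y \<in> V \<Longrightarrow> c * cos (y $ k) ^ n = d"
  shows "c = 0 \<and> d = 0"
proof -
  have "c = 0 \<and> (\<forall>y\<in>V. d = 0)"
  proof (rule independent_multiple_vanishes[OF V(1,2) eq has_pd_const[OF refl]])
    fix y assume "y \<in> V"
    then have y: "sin (y $ k) \<noteq> 0" "cos (y $ k) \<noteq> 0" using V by (auto simp: sphere_domain_def)
    show "has_pd (\<lambda>y. cos (y $ k) ^ n) k (real n * cos (y $ k) ^ (n - 1) * (- sin (y $ k))) y"
      by (rule has_pd_intros refl)+ simp
    show "real n * cos (y $ k) ^ (n - 1) * (- sin (y $ k)) \<noteq> 0" using y n by simp
  qed
  then show ?thesis using V by blast
qed

lemma three_least:
  assumes "CARD('n::{finite,linorder}) \<ge> 3"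
  obtains i j k :: "'n::{finite,linorder}" where "i < j" "j < k" "\<And>m. i \<le> m" "\<And>m. m \<noteq> i \<Longrightarrow> j \<le> m"
    "\<And>m. m \<noteq> i \<Longrightarrow> m \<noteq> j \<Longrightarrow> k \<le> m"
proof -
  define i where "i = Min (UNIV :: 'n::{finite,linorder} set)"
  define j where "j = Min (UNIV - {i})"
  define k where "k = Min (UNIV - {i, j})"
  have n1: "UNIV - {i} \<noteq> {}"
  proof
    assume "UNIV - {i} = {}"
    then have "(UNIV :: 'n set) = {i}" by auto
    then have "CARD('n) = 1" by (metis card_1_singleton_iff One_nat_def)
    with assms show False by simp
  qed
  have n2: "UNIV - {i, j} \<noteq> {}"
  proof
    assume "UNIV - {i, j} = {}"
    then have "(UNIV :: 'n set) = {i, j}" by auto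
    then have "CARD('n) = card {i, j}" by simp
    moreover have "card {i, j} \<le> 2" by (simp add: card_insert_if)
    ultimately show False using assms by simp
  qed
  have i: "i \<le> m" for m by (simp add: i_def)
  have j: "j \<in> UNIV - {i}" "m \<noteq> i \<Longrightarrow> j \<le> m" for m
    using Min_in[OF _ n1] by (auto simp: j_def)
  have k: "k \<in> UNIV - {i, j}" "m \<noteq> i \<Longrightarrow> m \<noteq> j \<Longrightarrow> k \<le> m" for m
    using Min_in[OF _ n2] by (auto simp: k_def)
  show thesis
    by (rule that[of i j k]) (use i j k in \<open>auto simp: less_le\<close>)
qed

section \<open>Generic conformal factors are not flat\<close>

context conformally_spherical
begin

text \<open>
  Here $t$ and $\upsilon_j$ vanish, so the sectional equation is
  $\upsilon_i' + \cot\phi_i\,\upsilon_i = 1$. For this $F$ it is a polynomial equation in $\cos\phi_i$,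
  whose coefficients must vanish because it holds on an open set.
\<close>

lemma one_angle_factor_not_flat:
  assumes flat: "flat_on U g" and ij: "i < j" "\<And>m. i \<le> m" "\<And>m. m \<noteq> i \<Longrightarrow> j \<le> m"
    and V: "open V" "V \<noteq> {}" "V \<subseteq> U"
    and F_eq: "\<And>y. y \<in> V \<Longrightarrow> F y = \<alpha> + \<beta> / (cos (y $ i))\<^sup>2"
  shows False
proof -
  note [simp] = sin_nz[OF subsetD[OF V(3)]] cos_nz[OF subsetD[OF V(3)]]
    F_nz[OF subsetD[OF V(3)]]
  have V_dom: "V \<subseteq> sphere_domain" using V(3) U_dom by blast
  let ?denom = "\<lambda>y. \<alpha> * cos (y $ i) ^ 3 + \<beta> * cos (y $ i)"
  have denom_eq: "?denom y = cos (y $ i) ^ 3 * F y" if "y \<in> V" for y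
    using that by (simp add: F_eq[OF that] field_simps power2_eq_square power3_eq_cube)
  have denom: "?denom y \<noteq> 0" if "y \<in> V" for y
    unfolding denom_eq[OF that] using that by simp
  have pd_F: "pd m F y = (if m = i then 2 * \<beta> * sin (y $ i) / cos (y $ i) ^ 3 else 0)"
    if y: "y \<in> V" for y m
  proof -
    have "has_pd (\<lambda>y. \<alpha> + \<beta> / (cos (y $ i))\<^sup>2) m
      (if m = i then 2 * \<beta> * sin (y $ i) / cos (y $ i) ^ 3 else 0) y"
      apply ((rule has_pd_intros refl)+ | (simp add: y; fail))+
      using y by (simp add: field_simps power2_eq_square power3_eq_cube)
    also have "?this \<longleftrightarrow> has_pd F m (if m = i then 2 * \<beta> * sin (y $ i) / cos (y $ i) ^ 3 else 0) y"
      by (rule has_pd_eq_on_open[OF V(1) y]) (simp add: F_eq)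
    finally show ?thesis by (rule has_pd_pd)
  qed
  have \<upsilon>_eq: "\<upsilon> m y = (if m = i then \<beta> * sin (y $ i) / ?denom y else 0)" if "y \<in> V" for y m
    using that denom[OF that] by (simp add: \<upsilon>_def pd_F denom_eq)
  have poly: "\<alpha>\<^sup>2 * cos (x $ i) ^ 6 + 3 * \<alpha> * \<beta> * cos (x $ i) ^ 4 - 3 * \<alpha> * \<beta> * cos (x $ i) ^ 2 - \<beta>\<^sup>2 = 0"
    if x: "x \<in> V" for x
  proof -
    have xU: "x \<in> U" using x V by blast
    let ?s = "sin (x $ i)" and ?c = "cos (x $ i)"
    have "has_pd (\<lambda>y. \<beta> * sin (y $ i) / ?denom y) i
      (\<beta> * ?c / ?denom x + \<beta> * ?s\<^sup>2 * (3 * \<alpha> * ?c\<^sup>2 + \<beta>) / (?denom x)\<^sup>2) x"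
      apply ((rule has_pd_intros refl)+ | (simp add: denom[OF x]; fail))+
      using denom[OF x] by (simp add: divide_simps) algebra
    also have "?this \<longleftrightarrow> has_pd (\<upsilon> i) i
      (\<beta> * ?c / ?denom x + \<beta> * ?s\<^sup>2 * (3 * \<alpha> * ?c\<^sup>2 + \<beta>) / (?denom x)\<^sup>2) x"
      by (rule has_pd_eq_on_open[OF V(1) x]) (simp add: \<upsilon>_eq)
    finally have 1: "pd i (\<upsilon> i) x =
      \<beta> * ?c / ?denom x + \<beta> * ?s\<^sup>2 * (3 * \<alpha> * ?c\<^sup>2 + \<beta>) / (?denom x)\<^sup>2" by (rule has_pd_pd)
    have "has_pd (\<lambda>y. 0) j 0 x" by (rule has_pd_const) simp
    also have "?this \<longleftrightarrow> has_pd (\<upsilon> j) j 0 x"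
      by (rule has_pd_eq_on_open[OF V(1) x]) (use ij in \<open>simp add: \<upsilon>_eq\<close>)
    finally have 2: "pd j (\<upsilon> j) x = 0" by (rule has_pd_pd)
    obtain t where "(\<And>m. m \<noteq> i \<Longrightarrow> m \<noteq> j \<Longrightarrow> \<upsilon> m x = 0) \<Longrightarrow> t = 0"
      "pd j (\<upsilon> j) x + t = ?s\<^sup>2 * (1 - pd i (\<upsilon> i) x - ?c / ?s * \<upsilon> i x)"
      using sectional_equation[OF xU flat ij] by metis
    with \<upsilon>_eq[OF x] 1 2 have "1 = \<beta> * ?c / ?denom x + \<beta> * ?s\<^sup>2 * (3 * \<alpha> * ?c\<^sup>2 + \<beta>) / (?denom x)\<^sup>2
      + ?c / ?s * (\<beta> * ?s / ?denom x)" using x by simp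
    then have "(?denom x)\<^sup>2 = 2 * \<beta> * ?c * ?denom x + \<beta> * ?s\<^sup>2 * (3 * \<alpha> * ?c\<^sup>2 + \<beta>)"
      using denom[OF x] x by (simp add: divide_simps) algebra
    then show ?thesis using sin_cos_squared_add[of "x $ i"] by algebra
  qed
  \<comment> \<open>Differentiating the polynomial twice, and dividing out the factors that do not vanish, leaves a relation with the single power $\cos^2\phi_i$.\<close>
  have "\<alpha> = 0"
  proof (rule ccontr)
    assume \<alpha>: "\<alpha> \<noteq> 0"
    have 1: "\<alpha> * cos (x $ i) ^ 4 + 2 * \<beta> * cos (x $ i) ^ 2 - \<beta> = 0" if x: "x \<in> V" for x
    proof -
      have "has_pd (\<lambda>x. \<alpha>\<^sup>2 * cos (x $ i) ^ 6 + 3 * \<alpha> * \<beta> * cos (x $ i) ^ 4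
          - 3 * \<alpha> * \<beta> * cos (x $ i) ^ 2 - \<beta>\<^sup>2) i
        (- 6 * \<alpha> * sin (x $ i) * cos (x $ i) * (\<alpha> * cos (x $ i) ^ 4 + 2 * \<beta> * cos (x $ i) ^ 2 - \<beta>)) x"
        by (rule has_pd_intros refl)+ (simp, algebra)
      also have "?this \<longleftrightarrow> has_pd (\<lambda>x. 0) i (- 6 * \<alpha> * sin (x $ i) * cos (x $ i) *
        (\<alpha> * cos (x $ i) ^ 4 + 2 * \<beta> * cos (x $ i) ^ 2 - \<beta>)) x"
        by (rule has_pd_eq_on_open[OF V(1) x]) (simp add: poly)
      finally show ?thesis using has_pd_unique[OF has_pd_const[OF refl]] \<alpha> x by fastforce
    qed
    have 2: "\<alpha> * cos (x $ i) ^ 2 = - \<beta>" if x: "x \<in> V" for x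
    proof -
      have "has_pd (\<lambda>x. \<alpha> * cos (x $ i) ^ 4 + 2 * \<beta> * cos (x $ i) ^ 2 - \<beta>) i
        (- 4 * sin (x $ i) * cos (x $ i) * (\<alpha> * cos (x $ i) ^ 2 + \<beta>)) x"
        by (rule has_pd_intros refl)+ (simp, algebra)
      also have "?this \<longleftrightarrow> has_pd (\<lambda>x. 0) i
        (- 4 * sin (x $ i) * cos (x $ i) * (\<alpha> * cos (x $ i) ^ 2 + \<beta>)) x"
        by (rule has_pd_eq_on_open[OF V(1) x]) (simp add: 1)
      finally show ?thesis using has_pd_unique[OF has_pd_const[OF refl]] x by fastforce
    qed
    from cos_power_multiple_vanishes[OF V(1,2) V_dom _ 2] \<alpha> show False by simp
  qed
  moreover obtain x where x: "x \<in> V" using V by blast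
  ultimately have "\<beta> = 0" using poly[OF x] by simp
  then show False using \<open>\<alpha> = 0\<close> F_eq[OF x] x by simp
qed

text \<open>
  Since $\upsilon_i = -\cot\phi_i$, the right-hand side of the sectional equation is zero, while its
  left-hand side is positive.
\<close>

lemma separated_factor_not_flat:
  assumes flat: "flat_on U g" and ij: "i < j" "\<And>m. i \<le> m" "\<And>m. m \<noteq> i \<Longrightarrow> j \<le> m"
    and x: "x \<in> U"
    and F_eq: "\<And>y. y \<in> U \<Longrightarrow> F y = A y / (sin (y $ i))\<^sup>2"
    and A: "\<And>y. y \<in> U \<Longrightarrow> has_pd A i 0 y"
    and j_pos: "pd j (\<upsilon> j) x > 0"
  shows False
proof -
  have A_nz: "A y \<noteq> 0" if "y \<in> U" for y using F_nz[OF that] F_eq[OF that] by auto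
  have \<upsilon>_eq: "\<upsilon> i y = - cos (y $ i) / sin (y $ i)" if y: "y \<in> U" for y
  proof -
    have "has_pd (\<lambda>y. A y / (sin (y $ i))\<^sup>2) i (- 2 * cos (y $ i) / sin (y $ i) * F y) y"
      apply ((rule A[OF y] has_pd_intros refl)+ | (simp add: sin_nz[OF y]; fail))+
      using y by (simp add: F_eq[OF y] field_simps power2_eq_square)
    also have "?this \<longleftrightarrow> has_pd F i (- 2 * cos (y $ i) / sin (y $ i) * F y) y"
      by (rule has_pd_eq_on_open[OF open_U y]) (simp add: F_eq)
    finally have "pd i F y = - 2 * cos (y $ i) / sin (y $ i) * F y" by (rule has_pd_pd)
    then show ?thesis using y by (simp add: \<upsilon>_def)
  qed
  have "has_pd (\<lambda>y. - 1 * cos (y $ i) / sin (y $ i)) i (1 + (cos (x $ i) / sin (x $ i))\<^sup>2) x"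
    apply ((rule has_pd_intros refl)+ | (simp add: sin_nz[OF x]; fail))+
    using x by (simp add: field_simps power2_eq_square)
  also have "?this \<longleftrightarrow> has_pd (\<upsilon> i) i (1 + (cos (x $ i) / sin (x $ i))\<^sup>2) x"
    by (rule has_pd_eq_on_open[OF open_U x]) (simp add: \<upsilon>_eq)
  finally have "pd i (\<upsilon> i) x = 1 + (cos (x $ i) / sin (x $ i))\<^sup>2" by (rule has_pd_pd)
  then have "1 - pd i (\<upsilon> i) x - cos (x $ i) / sin (x $ i) * \<upsilon> i x = 0"
    by (simp add: \<upsilon>_eq[OF x] power2_eq_square)
  then obtain t where "t \<ge> 0" "pd j (\<upsilon> j) x + t = 0"
    using sectional_equation[OF x flat ij] by (metis mult_zero_right)
  then show False using j_pos by simp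
qed

lemma generic_factor_not_flat:
  assumes card: "CARD('n) \<ge> 3" and ne: "U \<noteq> {}"
    and F_generic: "\<And>y. y \<in> U \<Longrightarrow> F y = generic_potential a0 a b y"
  shows "\<not> flat_on U g"
proof
  assume flat: "flat_on U g"
  obtain i j k :: 'n where ijk: "i < j" "j < k" "\<And>m. i \<le> m" "\<And>m. m \<noteq> i \<Longrightarrow> j \<le> m"
    "\<And>m. m \<noteq> i \<Longrightarrow> m \<noteq> j \<Longrightarrow> k \<le> m"
    using three_least[OF card] by metis
  have neq: "i \<noteq> j" "i \<noteq> k" "j \<noteq> k" "j \<noteq> i" "k \<noteq> i" "k \<noteq> j" using ijk by auto
  define T1 where "T1 = nested_potential a b (UNIV - {i})"
  define T2 where "T2 = nested_potential a b (UNIV - {i, j})"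
  define T3 where "T3 = nested_potential a b (UNIV - {i, j, k})"
  have F_T1: "F y = a0 + a i / (cos (y $ i))\<^sup>2 + T1 y / (sin (y $ i))\<^sup>2" if "y \<in> U" for y
    unfolding T1_def F_generic[OF that] generic_potential_nested
    by (subst nested_potential_least[of i]) (use ijk in auto)
  have T1_T2: "T1 y = a j / (cos (y $ j))\<^sup>2 + T2 y / (sin (y $ j))\<^sup>2" for y
    unfolding T1_def T2_def
    by (subst nested_potential_least[of j]) (use ijk neq in \<open>auto simp: Diff_insert2[symmetric] insert_commute\<close>)
  have T2_T3: "T2 y = a k / (cos (y $ k))\<^sup>2 + T3 y / (sin (y $ k))\<^sup>2" for y
  proof -
    have "UNIV - {i, j, k} = UNIV - {i, j} - {k}" by auto
    then show ?thesis unfolding T2_def T3_def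
      by (subst nested_potential_least[of k]) (use ijk neq in auto)
  qed
  have pd_T: "y \<in> U \<Longrightarrow> has_pd T1 i 0 y" "y \<in> U \<Longrightarrow> has_pd T2 i 0 y" "y \<in> U \<Longrightarrow> has_pd T2 j 0 y"
    "y \<in> U \<Longrightarrow> has_pd T3 i 0 y" "y \<in> U \<Longrightarrow> has_pd T3 j 0 y" "y \<in> U \<Longrightarrow> has_pd T3 k 0 y" for y
    unfolding T1_def T2_def T3_def
    by (rule has_pd_nested_potential; use U_dom in blast)+

  \<comment> \<open>The mixed equation for the first two angles, with the third as auxiliary index.\<close>
  have eq1: "(a j * (sin (x $ j) / cos (x $ j)) ^ 4 - T2 x) * (a0 + a i / cos (x $ i) ^ 4) = 0"
    if x: "x \<in> U" for x
  proof -
    let ?R' = "\<lambda>x. 2 * cos (x $ j) / sin (x $ j) ^ 3 * (a j * (sin (x $ j) / cos (x $ j)) ^ 4 - T2 x)"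
    have "?R' x * (2 * cos (x $ i) / sin (x $ i) * (a0 + a i / (cos (x $ i))\<^sup>2)
        + 2 * a i * sin (x $ i) / cos (x $ i) ^ 3) = 0"
    proof (rule mixed_equation_split[OF x flat neq(5,6) ijk(1) F_T1])
      fix y assume y: "y \<in> U"
      show "has_pd (\<lambda>y. a0 + a i / (cos (y $ i))\<^sup>2) j 0 y"
        by ((rule has_pd_intros refl)+ | (use neq y in \<open>simp; fail\<close>))+
      show "has_pd T1 j (?R' y) y"
        unfolding T1_T2[abs_def] by (rule has_pd_outer_term) (use y pd_T in auto)
    next
      show "has_pd (\<lambda>y. a0 + a i / (cos (y $ i))\<^sup>2) i (2 * a i * sin (x $ i) / cos (x $ i) ^ 3) x"
        apply ((rule has_pd_intros refl)+ | (simp add: cos_nz[OF x]; fail))+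
        using x by (simp add: field_simps power2_eq_square power3_eq_cube)
      show "has_pd T1 i 0 x" using x pd_T by blast
      show "has_pd ?R' i 0 x"
        by ((rule pd_T(2)[OF x] has_pd_intros refl)+ | (use neq x in \<open>simp; fail\<close>))+
    qed
    moreover have "2 * cos (x $ i) / sin (x $ i) * (a0 + a i / (cos (x $ i))\<^sup>2)
        + 2 * a i * sin (x $ i) / cos (x $ i) ^ 3
      = 2 * cos (x $ i) / sin (x $ i) * (a0 + a i / cos (x $ i) ^ 4)"
      using x by (simp add: divide_simps) (use sin_cos_squared_add3[of "x $ i"] in algebra)
    ultimately show ?thesis using x by simp
  qed

  have "a0 = 0 \<and> a i = 0"
  proof (rule ccontr)
    assume nz: "\<not> (a0 = 0 \<and> a i = 0)"
    \<comment> \<open>Where the second factor of \<open>eq1\<close> does not vanish, the first one does.\<close>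
    define V where "V = {y \<in> U. a0 * cos (y $ i) ^ 4 + a i \<noteq> 0}"
    have "open V"
    proof -
      have "open (U \<inter> (\<lambda>y. a0 * cos (y $ i) ^ 4 + a i) -` (- {0}))"
        by (auto intro!: open_Int open_U open_vimage continuous_intros)
      then show ?thesis unfolding V_def by (simp add: Int_def vimage_def)
    qed
    have "V \<noteq> {}"
    proof
      assume "V = {}"
      then have "a0 * cos (y $ i) ^ 4 = - a i" if "y \<in> U" for y
        using that unfolding V_def by (auto simp: add_eq_0_iff)
      from cos_power_multiple_vanishes[OF open_U ne U_dom _ this] nz show False by simp
    qed
    have VU: "V \<subseteq> U" by (auto simp: V_def)
    have "a j * (sin (y $ j) / cos (y $ j)) ^ 4 = T2 y" if "y \<in> V" for y
    proof -
      have "a0 + a i / cos (y $ i) ^ 4 = (a0 * cos (y $ i) ^ 4 + a i) / cos (y $ i) ^ 4"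
        using that VU by (auto simp: field_simps)
      then show ?thesis using eq1[of y] that by (auto simp: V_def)
    qed
    from tan_power4_multiple_vanishes[OF \<open>open V\<close> \<open>V \<noteq> {}\<close> _ this] VU U_dom pd_T(3)
    have "a j = 0 \<and> (\<forall>y\<in>V. T2 y = 0)" by blast
    then have "F y = a0 + a i / (cos (y $ i))\<^sup>2" if "y \<in> V" for y
      using that VU by (auto simp: F_T1 T1_T2)
    from one_angle_factor_not_flat[OF flat ijk(1,3,4) \<open>open V\<close> \<open>V \<noteq> {}\<close> VU this]
    show False .
  qed
  then have F_T1': "F y = T1 y / (sin (y $ i))\<^sup>2" if "y \<in> U" for y
    using that by (simp add: F_T1)

  \<comment> \<open>The mixed equation for the second and third angles, with the first as auxiliary index.\<close>
  have eq2: "a k * (sin (x $ k) / cos (x $ k)) ^ 4 = T3 x" if x: "x \<in> U" and aj: "a j \<noteq> 0" for x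
  proof -
    let ?R' = "\<lambda>x. 2 * cos (x $ k) / sin (x $ k) ^ 3 *
      (a k * (sin (x $ k) / cos (x $ k)) ^ 4 - T3 x) / (sin (x $ i))\<^sup>2"
    have "?R' x * (2 * cos (x $ j) / sin (x $ j) * (a j / (cos (x $ j))\<^sup>2 / (sin (x $ i))\<^sup>2)
        + 2 * a j * sin (x $ j) / cos (x $ j) ^ 3 / (sin (x $ i))\<^sup>2) = 0"
    proof (rule mixed_equation_split[OF x flat neq(1,2) ijk(2)])
      fix y assume y: "y \<in> U"
      show "F y = a j / (cos (y $ j))\<^sup>2 / (sin (y $ i))\<^sup>2 + T2 y / (sin (y $ i))\<^sup>2 / (sin (y $ j))\<^sup>2"
        by (simp add: F_T1'[OF y] T1_T2 add_divide_distrib mult_ac)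
      show "has_pd (\<lambda>y. a j / (cos (y $ j))\<^sup>2 / (sin (y $ i))\<^sup>2) k 0 y"
        by ((rule has_pd_intros refl)+ | (use neq y in \<open>simp; fail\<close>))+
      have "has_pd T2 k (2 * cos (y $ k) / sin (y $ k) ^ 3 *
          (a k * (sin (y $ k) / cos (y $ k)) ^ 4 - T3 y)) y"
        unfolding T2_T3[abs_def] by (rule has_pd_outer_term) (use y pd_T in auto)
      then show "has_pd (\<lambda>y. T2 y / (sin (y $ i))\<^sup>2) k (?R' y) y"
        by (rule has_pd_divide[where b = 0]) (use neq y in \<open>auto intro!: has_pd_power has_pd_sin has_pd_coord\<close>)
    next
      show "has_pd (\<lambda>y. a j / (cos (y $ j))\<^sup>2 / (sin (y $ i))\<^sup>2) j
        (2 * a j * sin (x $ j) / cos (x $ j) ^ 3 / (sin (x $ i))\<^sup>2) x"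
        apply ((rule has_pd_intros refl)+ | (simp add: cos_nz[OF x] sin_nz[OF x]; fail))+
        using x neq by (simp add: field_simps power2_eq_square power3_eq_cube)
      show "has_pd (\<lambda>y. T2 y / (sin (y $ i))\<^sup>2) j 0 x"
        by ((rule pd_T(3)[OF x] has_pd_intros refl)+ | (use neq x in \<open>simp; fail\<close>))+
      show "has_pd ?R' j 0 x"
        by ((rule pd_T(5)[OF x] has_pd_intros refl)+ | (use neq x in \<open>simp; fail\<close>))+
    qed
    moreover have "2 * cos (x $ j) / sin (x $ j) * (a j / (cos (x $ j))\<^sup>2 / (sin (x $ i))\<^sup>2)
        + 2 * a j * sin (x $ j) / cos (x $ j) ^ 3 / (sin (x $ i))\<^sup>2
      = 2 * a j / (sin (x $ j) * cos (x $ j) ^ 3 * (sin (x $ i))\<^sup>2)"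
      using x by (simp add: divide_simps) (use sin_cos_squared_add3[of "x $ j"] in algebra)
    ultimately show ?thesis using x aj by simp
  qed

  obtain x where x: "x \<in> U" using ne by blast
  have "pd j (\<upsilon> j) x > 0"
  \<comment> \<open>Either $F$ is proportional to $1/\sin^2\phi_j$ or to $1/\cos^2\phi_j$ as a function of $\phi_j$.\<close>
  proof (cases "a j = 0")
    case True
    have \<upsilon>_eq: "\<upsilon> j y = - cos (y $ j) / sin (y $ j)" if y: "y \<in> U" for y
    proof -
      have "has_pd (\<lambda>y. T2 y / (sin (y $ j))\<^sup>2 / (sin (y $ i))\<^sup>2) j
        (- 2 * cos (y $ j) / sin (y $ j) * F y) y"
        apply ((rule pd_T(3)[OF y] has_pd_intros refl)+ | (simp add: sin_nz[OF y]; fail))+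
        using y neq True by (simp add: F_T1'[OF y] T1_T2 field_simps power2_eq_square)
      also have "?this \<longleftrightarrow> has_pd F j (- 2 * cos (y $ j) / sin (y $ j) * F y) y"
        by (rule has_pd_eq_on_open[OF open_U y]) (simp add: F_T1' T1_T2 True)
      finally have "pd j F y = - 2 * cos (y $ j) / sin (y $ j) * F y" by (rule has_pd_pd)
      then show ?thesis using y by (simp add: \<upsilon>_def)
    qed
    have "has_pd (\<lambda>y. - 1 * cos (y $ j) / sin (y $ j)) j (1 + (cos (x $ j) / sin (x $ j))\<^sup>2) x"
      apply ((rule has_pd_intros refl)+ | (simp add: sin_nz[OF x]; fail))+
      using x by (simp add: field_simps power2_eq_square)
    also have "?this \<longleftrightarrow> has_pd (\<upsilon> j) j (1 + (cos (x $ j) / sin (x $ j))\<^sup>2) x"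
      by (rule has_pd_eq_on_open[OF open_U x]) (simp add: \<upsilon>_eq)
    finally have "pd j (\<upsilon> j) x = 1 + (cos (x $ j) / sin (x $ j))\<^sup>2" by (rule has_pd_pd)
    then show ?thesis by (simp add: add_pos_nonneg)
  next
    case False
    have "a k = 0 \<and> (\<forall>y\<in>U. T3 y = 0)"
      using tan_power4_multiple_vanishes[OF open_U ne U_dom eq2[OF _ False]] pd_T(6) by blast
    then have F_eq: "F y = a j / (cos (y $ j))\<^sup>2 / (sin (y $ i))\<^sup>2" if "y \<in> U" for y
      using that by (simp add: F_T1' T1_T2 T2_T3)
    have \<upsilon>_eq: "\<upsilon> j y = sin (y $ j) / cos (y $ j)" if y: "y \<in> U" for y
    proof -
      have "has_pd (\<lambda>y. a j / (cos (y $ j))\<^sup>2 / (sin (y $ i))\<^sup>2) j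
        (2 * sin (y $ j) / cos (y $ j) * F y) y"
        apply ((rule has_pd_intros refl)+ | (simp add: sin_nz[OF y] cos_nz[OF y]; fail))+
        using y neq by (simp add: F_eq[OF y] field_simps power2_eq_square)
      also have "?this \<longleftrightarrow> has_pd F j (2 * sin (y $ j) / cos (y $ j) * F y) y"
        by (rule has_pd_eq_on_open[OF open_U y]) (simp add: F_eq)
      finally have "pd j F y = 2 * sin (y $ j) / cos (y $ j) * F y" by (rule has_pd_pd)
      then show ?thesis using y by (simp add: \<upsilon>_def)
    qed
    have "has_pd (\<lambda>y. sin (y $ j) / cos (y $ j)) j (1 + (sin (x $ j) / cos (x $ j))\<^sup>2) x"
      apply ((rule has_pd_intros refl)+ | (simp add: cos_nz[OF x]; fail))+
      using x by (simp add: field_simps power2_eq_square)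
    also have "?this \<longleftrightarrow> has_pd (\<upsilon> j) j (1 + (sin (x $ j) / cos (x $ j))\<^sup>2) x"
      by (rule has_pd_eq_on_open[OF open_U x]) (simp add: \<upsilon>_eq)
    finally have "pd j (\<upsilon> j) x = 1 + (sin (x $ j) / cos (x $ j))\<^sup>2" by (rule has_pd_pd)
    then show ?thesis by (simp add: add_pos_nonneg)
  qed
  from separated_factor_not_flat[OF flat ijk(1,3,4) x F_T1' pd_T(1) this] show False .
qed

end

section \<open>Conformal equivalence with a flat system\<close>

lemma constant_in_compatible_potentials:
  fixes U :: "(real^'n::finite) set"
  shows "(\<lambda>_. c) \<in> compatible_potentials U g \<K>"
proof -
  have pd_const: "pd i (\<lambda>_::real^'n. d) = (\<lambda>_. 0)" for i :: "'n" and d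
    by (rule ext) (auto intro: has_pd_pd has_pd_const)
  have "\<exists>d. foldr pd ks (\<lambda>_::real^'n. c) = (\<lambda>_. d)" for ks
    by (induction ks) (auto simp: pd_const)
  then have "foldr pd ks (\<lambda>_::real^'n. c) differentiable (at x)" for ks x
    by (metis differentiable_const)
  moreover have "K_dV g K (\<lambda>_. c) = (\<lambda>_. 0)" for K
    by (rule ext) (simp add: K_dV_def grad_def pd_const zero_vec_def[symmetric])
  ultimately show ?thesis
    by (auto simp: compatible_potentials_def smooth_on_def compatible_def pd_const)
qed

lemma symmetric_quadratic_form_zero:
  fixes M :: "real^'n::finite^'n"
  assumes sym: "transpose M = M" and zero: "\<And>p. (\<Sum>i\<in>UNIV. \<Sum>j\<in>UNIV. M $ i $ j * p $ i * p $ j) = 0"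
  shows "M = 0"
proof -
  have q: "(\<Sum>i\<in>UNIV. \<Sum>j\<in>UNIV. M $ i $ j * p $ i * p $ j) = p \<bullet> (M *v p)" for p
    by (simp add: inner_vec_def matrix_vector_mult_def sum_distrib_left mult_ac)
  have z: "p \<bullet> (M *v p) = 0" for p using zero q by metis
  have s: "p \<bullet> (M *v q) = q \<bullet> (M *v p)" for p q
    using sym by (metis dot_lmul_matrix inner_commute transpose_matrix_vector)
  have "p \<bullet> (M *v q) = 0" for p q
    using z[of "p + q"] z[of p] z[of q] s[of p q]
    by (simp add: matrix_vector_right_distrib inner_add_left inner_add_right)
  then have "M *v q = 0" for q by (metis inner_eq_zero_iff)
  then show ?thesis by (metis matrix_eq matrix_vector_mult_0)
qed

lemma matrix_inv_inverse:
  fixes A :: "real^'n::finite^'n"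
  assumes "invertible A"
  shows "A ** matrix_inv A = mat 1" "matrix_inv A ** A = mat 1"
proof -
  have "A ** matrix_inv A = mat 1 \<and> matrix_inv A ** A = mat 1"
    unfolding matrix_inv_def by (rule someI_ex) (use assms invertible_def in blast)
  then show "A ** matrix_inv A = mat 1" "matrix_inv A ** A = mat 1" by auto
qed

lemma transpose_matrix_inv:
  fixes A :: "real^'n::finite^'n"
  assumes "invertible A" "transpose A = A"
  shows "transpose (matrix_inv A) = matrix_inv A"
proof -
  have "transpose (matrix_inv A) ** A = mat 1"
    using matrix_inv_inverse[OF assms(1)] assms(2) by (metis matrix_transpose_mul transpose_mat)
  then show ?thesis
    using matrix_inv_inverse[OF assms(1)] by (metis matrix_mul_assoc matrix_mul_lid matrix_mul_rid)
qed

text \<open>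
  At zero momentum the Hamiltonians reduce to the potentials; subtracting these leaves two quadratic
  forms, whose symmetric matrices are the inverse metrics.
\<close>

lemma metric_of_rescaled_hamiltonian:
  assumes resc: "rescaled_hamiltonian U \<Omega> (hamiltonian g V) (hamiltonian g' V')"
    and x: "x \<in> U" and \<Omega>: "\<Omega> x \<noteq> 0"
    and g: "transpose (g x) = g x" "invertible (g x)"
    and g': "transpose (g' x) = g' x" "invertible (g' x)"
  shows "V' x = V x / (\<Omega> x)\<^sup>2" "g' x = (\<Omega> x)\<^sup>2 *\<^sub>R g x"
proof -
  have eq: "hamiltonian g' V' x p = hamiltonian g V x p / (\<Omega> x)\<^sup>2" for p
    using resc x by (simp add: rescaled_hamiltonian_def)
  from eq[of 0] show V: "V' x = V x / (\<Omega> x)\<^sup>2" by (simp add: hamiltonian_def)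
  define M where "M = matrix_inv (g' x) - (1 / (\<Omega> x)\<^sup>2) *\<^sub>R matrix_inv (g x)"
  have "M = 0"
  proof (rule symmetric_quadratic_form_zero)
    show "transpose M = M"
      using transpose_matrix_inv[OF g(2,1)] transpose_matrix_inv[OF g'(2,1)]
      by (simp add: M_def transpose_def vec_eq_iff)
    show "(\<Sum>i\<in>UNIV. \<Sum>j\<in>UNIV. M $ i $ j * p $ i * p $ j) = 0" for p
      using eq[of p] V
      by (simp add: M_def hamiltonian_def left_diff_distrib sum_subtractf add_divide_distrib
          sum_divide_distrib)
  qed
  then have "matrix_inv (g' x) = (1 / (\<Omega> x)\<^sup>2) *\<^sub>R matrix_inv (g x)" by (simp add: M_def)
  then have "matrix_inv (g' x) ** ((\<Omega> x)\<^sup>2 *\<^sub>R g x) = mat 1"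
    using matrix_inv_inverse[OF g(2)] \<Omega>
    by (simp add: matrix_scalar_ac scalar_matrix_assoc[symmetric] matrix_mul_lid)
  then show "g' x = (\<Omega> x)\<^sup>2 *\<^sub>R g x"
    using matrix_inv_inverse[OF g'(2)] by (metis matrix_mul_assoc matrix_mul_lid matrix_mul_rid)
qed

lemma sphere_metric_nondegenerate:
  assumes "x \<in> sphere_domain"
  shows "transpose (sphere_metric x) = sphere_metric x" "invertible (sphere_metric x)"
proof -
  show "transpose (sphere_metric x) = sphere_metric x"
    by (auto simp: transpose_def sphere_metric_def vec_eq_iff)
  have "det (sphere_metric x) = (\<Prod>i\<in>UNIV. sphere_metric x $ i $ i)"
    by (rule det_diagonal) (simp add: sphere_metric_def)
  also have "\<dots> \<noteq> 0" using assms by (auto simp: sphere_metric_def sphere_domain_def)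
  finally show "invertible (sphere_metric x)" by (simp add: invertible_det_nz)
qed

theorem theorem6p16:
  fixes U :: "(real^'n::{finite,linorder}) set"
  assumes "CARD('n) \<ge> 3"
    and "open U" and "connected U" and "U \<noteq> {}" and "U \<subseteq> sphere_domain"
  shows "\<not> (\<exists>S. properly_superintegrable S \<and> flat_on (dom S) (metric S) \<and>
                conformally_equivalent (generic_sphere_system U) S)"
proof
  assume "\<exists>S. properly_superintegrable S \<and> flat_on (dom S) (metric S) \<and>
                conformally_equivalent (generic_sphere_system U) S"
  then obtain S :: "'n system" where S: "properly_superintegrable S" and flat: "flat_on (dom S) (metric S)"
    and equiv: "conformally_equivalent (generic_sphere_system U) S" by blast
  have dom: "dom S = U" using equiv by (simp add: conformally_equivalent_def generic_sphere_system_def)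
  obtain \<Omega> where \<Omega>: "smooth_on U \<Omega>" "\<And>x. x \<in> U \<Longrightarrow> \<Omega> x \<noteq> 0"
    and from_S: "\<And>V'. V' \<in> potentials S \<Longrightarrow> \<exists>V \<in> generic_potentials U.
           rescaled_hamiltonian U \<Omega> (hamiltonian sphere_metric V) (hamiltonian (metric S) V')"
    using equiv by (auto simp: conformally_equivalent_def generic_sphere_system_def)
  have "(\<lambda>_. 1) \<in> potentials S"
    using S constant_in_compatible_potentials unfolding properly_superintegrable_def by metis
  then obtain V where V: "V \<in> generic_potentials U"
    and resc: "rescaled_hamiltonian U \<Omega> (hamiltonian sphere_metric V) (hamiltonian (metric S) (\<lambda>_. 1))"
    using from_S by blast
  from V obtain a0 a b where V_eq: "\<And>x. x \<in> U \<Longrightarrow> V x = generic_potential a0 a b x"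
    by (auto simp: generic_potentials_def)
  have nondeg: "transpose (metric S x) = metric S x" "invertible (metric S x)" if "x \<in> U" for x
    using S that dom by (auto simp: properly_superintegrable_def pseudo_riemannian_def)
  have m: "1 = V x / (\<Omega> x)\<^sup>2" "metric S x = (\<Omega> x)\<^sup>2 *\<^sub>R sphere_metric x" if "x \<in> U" for x
    using metric_of_rescaled_hamiltonian[OF resc that \<Omega>(2)[OF that]
        sphere_metric_nondegenerate[of x] nondeg[OF that]] that assms(5) by auto
  \<comment> \<open>The factor is taken as $\Omega^2$ rather than as the generic potential, with which it agrees on \<open>U\<close> only, so that its derivatives inherit differentiability from $\Omega$.\<close>
  define F where "F x = (\<Omega> x)\<^sup>2" for x
  have \<Omega>_diff: "\<Omega> differentiable (at x)" "pd k \<Omega> differentiable (at x)" if "x \<in> U" for x k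
    using \<Omega>(1) that unfolding smooth_on_def
    by (metis foldr.simps(1) id_apply, metis foldr_Cons foldr_Nil comp_apply id_apply)
  have pd_F: "has_pd F k (2 * \<Omega> x * pd k \<Omega> x) x" if "x \<in> U" for x k
    unfolding F_def[abs_def] by (rule has_pd_power[OF has_pdI[OF \<Omega>_diff(1)[OF that]]]) simp
  interpret conformally_spherical U F "metric S"
  proof
    show "open U" "U \<subseteq> sphere_domain" by fact+
    fix x assume x: "x \<in> U"
    show "metric S x = F x *\<^sub>R sphere_metric x" using m[OF x] by (simp add: F_def)
    show "F x > 0" using \<Omega>(2)[OF x] by (simp add: F_def)
    show "F differentiable (at x)" using pd_F[OF x] has_pd_differentiable by blast
    show "pd k F differentiable (at x)" for k
    proof -
      have "has_pd (\<lambda>y. 2 * \<Omega> y * pd k \<Omega> y) k (2 * \<Omega> x * pd k (pd k \<Omega>) x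
          + 2 * pd k \<Omega> x * pd k \<Omega> x) x"
        by (rule has_pd_mult[OF has_pd_mult[OF has_pd_const[OF refl] has_pdI] has_pdI])
          (use \<Omega>_diff[OF x] in auto)
      also have "?this \<longleftrightarrow> has_pd (pd k F) k (2 * \<Omega> x * pd k (pd k \<Omega>) x
          + 2 * pd k \<Omega> x * pd k \<Omega> x) x"
        by (rule has_pd_eq_on_open[OF assms(2) x]) (simp add: has_pd_pd[OF pd_F])
      finally show ?thesis by (rule has_pd_differentiable)
    qed
  qed
  have "F x = generic_potential a0 a b x" if "x \<in> U" for x
    using m(1)[OF that] \<Omega>(2)[OF that] V_eq[OF that] by (simp add: F_def)
  from generic_factor_not_flat[OF assms(1,4) this] flat dom show False by simp
qed

end
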